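(* Let $G$ be a connected graph on $n\geq 11$ vertices and $m$ edges with minimum degree $\delta\geq 3$. If $$m\geq \binom{n-3}{2}+13,$$ then $G$ is Hamilton-connected unless one of the following holds: (a) $G\in \left(\bigcup_{i=0}^{n-10}\mathcal{S}_{n}^{3}(i)\right)\cup\left(\bigcup_{i=0}^{n-11}\mathcal{T}_{n}^{3}(i)\right)$; (b) $n=11$ and $G=S_{11}^{5}$; (c) $n=12$ and $G\in \bigcup_{i=0}^{2}\mathcal{S}_{12}^{6}(i)$; (d) $n=13$ and $G=S_{13}^{6}$; (e) $n=14$ and $G\in \left(\bigcup_{i=0}^{2}\mathcal{S}_{14}^{7}(i)\right)\cup\mathcal{S}_{14}^{3}(4)$; (f) $n=16$ and $G\in \left(\bigcup_{i=0}^{1}\mathcal{S}_{16}^{8}(i)\right)\cup\{K_{7}\vee (K_{2}+K_{1,6})\}$.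
   Context: All graphs are finite and simple (no loops or multiple edges); equality of graphs and membership in a family of graphs are up to isomorphism. $\delta=\delta(G)$ is the minimum degree of $G$. A Hamilton path is a path containing all vertices of $G$; $G$ is Hamilton-connected if every two (distinct) vertices of $G$ are connected by a Hamilton path. $G+H$ and $G\vee H$ denote the disjoint union and the join of $G$ and $H$; $kG$ is the disjoint union of $k$ copies of $G$; $K_n$ is the complete graph on $n$ vertices and $K_{a,b}$ the complete bipartite graph. For $n\geq 5$ and $1\leq k\leq n/2$, define $$S_{n}^{k}=K_{k}\vee (K_{n-(2k-1)}+(k-1)K_{1}),\qquad T_{n}^{k}=K_{2}\vee (K_{n-(k+1)}+K_{k-1}).$$ For $t\geq 1$, $\mathcal{S}_{n}^{k}(t)$ (resp. $\mathcal{T}_{n}^{k}(t)$) denotes the set of all graphs obtained from $S_{n}^{k}$ (resp. $T_{n}^{k}$) by deleting exactly $t$ edges such that the resulting graph has minimum degree at least $3$. Also $\mathcal{S}_{n}^{k}(0)=\{S_{n}^{k}\}$ and $\mathcal{T}_{n}^{k}(0)=\{T_{n}^{k}\}$. *)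

theory Defs
  imports Main
begin

section \<open>Finite simple graphs\<close>

record 'a sgraph =
  vset :: "'a set"
  eset :: "'a set set"

definition simple_graph :: "'a sgraph \<Rightarrow> bool" where
  "simple_graph G \<longleftrightarrow>
     finite (vset G) \<and> (\<forall>e \<in> eset G. e \<subseteq> vset G \<and> card e = 2)"

definition graph_adj :: "'a sgraph \<Rightarrow> 'a \<Rightarrow> 'a \<Rightarrow> bool" where
  "graph_adj G u v \<longleftrightarrow> {u, v} \<in> eset G"

definition vertex_degree :: "'a sgraph \<Rightarrow> 'a \<Rightarrow> nat" where
  "vertex_degree G v = card {e \<in> eset G. v \<in> e}"

text \<open>Only meaningful for graphs with a finite, nonempty vertex set.\<close>

definition min_degree :: "'a sgraph \<Rightarrow> nat" where
  "min_degree G = Min (vertex_degree G ` vset G)"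

definition graph_path :: "'a sgraph \<Rightarrow> 'a \<Rightarrow> 'a list \<Rightarrow> 'a \<Rightarrow> bool" where
  "graph_path G u p v \<longleftrightarrow>
     p \<noteq> [] \<and> hd p = u \<and> last p = v \<and> set p \<subseteq> vset G \<and> distinct p \<and>
     successively (graph_adj G) p"

definition graph_connected :: "'a sgraph \<Rightarrow> bool" where
  "graph_connected G \<longleftrightarrow>
     vset G \<noteq> {} \<and> (\<forall>u \<in> vset G. \<forall>v \<in> vset G. \<exists>p. graph_path G u p v)"

definition hamilton_connected :: "'a sgraph \<Rightarrow> bool" where
  "hamilton_connected G \<longleftrightarrow>
     (\<forall>u \<in> vset G. \<forall>v \<in> vset G. u \<noteq> v \<longrightarrow>
        (\<exists>p. graph_path G u p v \<and> set p = vset G))"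

definition graph_iso :: "'a sgraph \<Rightarrow> 'b sgraph \<Rightarrow> bool" where
  "graph_iso G H \<longleftrightarrow>
     (\<exists>f. bij_betw f (vset G) (vset H) \<and>
        (\<forall>u \<in> vset G. \<forall>v \<in> vset G. graph_adj G u v \<longleftrightarrow> graph_adj H (f u) (f v)))"

text \<open>Membership in a family of graphs is understood up to isomorphism.\<close>

definition in_family :: "'a sgraph \<Rightarrow> 'b sgraph set \<Rightarrow> bool" where
  "in_family G \<F> \<longleftrightarrow> (\<exists>H \<in> \<F>. graph_iso G H)"


section \<open>Graph operations\<close>

definition complete_graph :: "nat \<Rightarrow> nat sgraph" where
  "complete_graph n = \<lparr>vset = {..<n}, eset = {e. e \<subseteq> {..<n} \<and> card e = 2}\<rparr>"

definition disjoint_union :: "'a sgraph \<Rightarrow> 'b sgraph \<Rightarrow> ('a + 'b) sgraph" where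
  "disjoint_union G H =
     \<lparr>vset = vset G <+> vset H,
      eset = (\<lambda>e. Inl ` e) ` eset G \<union> (\<lambda>e. Inr ` e) ` eset H\<rparr>"

definition graph_join :: "'a sgraph \<Rightarrow> 'b sgraph \<Rightarrow> ('a + 'b) sgraph" where
  "graph_join G H =
     \<lparr>vset = vset G <+> vset H,
      eset = eset (disjoint_union G H) \<union> {{Inl u, Inr v} | u v. u \<in> vset G \<and> v \<in> vset H}\<rparr>"

definition graph_copies :: "nat \<Rightarrow> 'a sgraph \<Rightarrow> (nat \<times> 'a) sgraph" where
  "graph_copies k G =
     \<lparr>vset = {..<k} \<times> vset G,
      eset = (\<Union>i<k. (\<lambda>e. Pair i ` e) ` eset G)\<rparr>"

definition complete_bipartite_graph :: "nat \<Rightarrow> nat \<Rightarrow> (nat + nat) sgraph" where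
  "complete_bipartite_graph a b =
     \<lparr>vset = {..<a} <+> {..<b},
      eset = {{Inl u, Inr v} | u v. u < a \<and> v < b}\<rparr>"


section \<open>The exceptional families\<close>

text \<open>
  The truncated subtractions below agree with the integer ones in the intended range
  \<^prop>\<open>n \<ge> 5\<close>, \<^prop>\<open>1 \<le> k\<close>, \<^prop>\<open>2 * k \<le> n\<close>.
\<close>

definition S_graph :: "nat \<Rightarrow> nat \<Rightarrow> (nat + nat + nat \<times> nat) sgraph" where
  "S_graph n k =
     graph_join (complete_graph k)
       (disjoint_union (complete_graph (n - (2 * k - 1))) (graph_copies (k - 1) (complete_graph 1)))"

definition T_graph :: "nat \<Rightarrow> nat \<Rightarrow> (nat + nat + nat) sgraph" where
  "T_graph n k =
     graph_join (complete_graph 2)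
       (disjoint_union (complete_graph (n - (k + 1))) (complete_graph (k - 1)))"

definition delete_edges :: "'a sgraph \<Rightarrow> 'a set set \<Rightarrow> 'a sgraph" where
  "delete_edges G F = \<lparr>vset = vset G, eset = eset G - F\<rparr>"

text \<open>The case \<^prop>\<open>t = 0\<close> carries no condition on the minimum degree.\<close>

definition deletion_family :: "'a sgraph \<Rightarrow> nat \<Rightarrow> 'a sgraph set" where
  "deletion_family H t =
     (if t = 0 then {H}
      else {delete_edges H F | F. F \<subseteq> eset H \<and> card F = t \<and> min_degree (delete_edges H F) \<ge> 3})"

definition S_family :: "nat \<Rightarrow> nat \<Rightarrow> nat \<Rightarrow> (nat + nat + nat \<times> nat) sgraph set" where
  "S_family n k t = deletion_family (S_graph n k) t"

definition T_family :: "nat \<Rightarrow> nat \<Rightarrow> nat \<Rightarrow> (nat + nat + nat) sgraph set" where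
  "T_family n k t = deletion_family (T_graph n k) t"

end

theory Submission
  imports Defs
begin

text \<open>
  The proof rests on the closure idea of Bondy and Chvatal, in the form suited to
  Hamilton-connectedness: if \<open>u\<close> and \<open>v\<close> are not adjacent and their degrees sum to more than
  \<open>n\<close>, then adding the edge \<open>uv\<close> cannot create Hamilton-connectedness
  (\<open>hamilton_connected_remove_edge\<close>). A graph that is not Hamilton-connected therefore lies in an
  edge-maximal one \<open>H\<close> on the same vertices, and in \<open>H\<close> every nonadjacent pair has degree sum at most
  \<open>n\<close> (\<open>maximal_extension\<close>). Each family in the conclusion is obtained by deleting edges from one
  graph, so it suffices to show that \<open>H\<close> is \<open>T_graph n 3\<close>, or \<open>S_graph n k\<close> with \<open>k = 3\<close> or with one
  of five sporadic pairs \<open>(n, k)\<close>; the number of deleted edges is then bounded by the edge count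
  alone.

  To identify \<open>H\<close>, a nonadjacent pair of maximal degree sum, with smaller degree \<open>k\<close>, yields a set \<open>L\<close>
  of \<open>k - 1\<close> vertices of degree at most \<open>k\<close>, where \<open>2 * k \<le> n\<close> (\<open>low_degree_set\<close>). Separating
  the edges that meet \<open>L\<close> from those that do not shows that \<open>H\<close> has at most
  \<open>((n - k + 1) choose 2) + k * (k - 1)\<close> edges. Compared with the
  hypothesis on the number of edges this leaves \<open>k = 3\<close> and the sporadic pairs
  (\<open>critical_parameters\<close>), and for the sporadic pairs the two bounds differ by at most two. So
  little room remains that the condition on degree sums fixes \<open>H\<close>: the vertices outside \<open>L\<close> form a
  clique (\<open>dense_part_complete\<close>), all vertices of \<open>L\<close> have the same neighbours \<open>C\<close> outside \<open>L\<close>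
  (\<open>common_neighbourhood\<close>), and either \<open>C\<close> has \<open>k\<close> elements and \<open>L\<close> is independent, or \<open>k = 3\<close>, \<open>C\<close> has
  two elements and \<open>L\<close> is an edge (\<open>closed_graph_structure\<close>). These are the two shapes above.
\<close>

section \<open>Degrees and edge counts\<close>

definition nbrs :: "'a sgraph \<Rightarrow> 'a \<Rightarrow> 'a set" where
  "nbrs G v = {w. graph_adj G v w}"

lemma graph_adj_sym: "graph_adj G u v \<longleftrightarrow> graph_adj G v u"
  by (simp add: graph_adj_def insert_commute)

lemma graph_adjD:
  assumes "simple_graph G" "graph_adj G u v"
  shows "u \<in> vset G" "v \<in> vset G" "u \<noteq> v"
  using assms by (auto simp: simple_graph_def graph_adj_def dest!: bspec)

lemma nbrs_subset: "simple_graph G \<Longrightarrow> nbrs G v \<subseteq> vset G - {v}"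
  by (auto simp: nbrs_def dest: graph_adjD)

lemma finite_nbrs: "simple_graph G \<Longrightarrow> finite (nbrs G v)"
  by (rule finite_subset[OF nbrs_subset]) (auto simp: simple_graph_def)

lemma finite_eset: "simple_graph G \<Longrightarrow> finite (eset G)"
  by (rule finite_subset[of _ "Pow (vset G)"]) (auto simp: simple_graph_def)

lemma edge_other_end:
  assumes "card e = 2" "v \<in> e"
  obtains w where "e = {v, w}" "w \<noteq> v"
  using assms by (auto simp: card_2_iff)

lemma vertex_degree_eq_card_nbrs:
  assumes "simple_graph G"
  shows "vertex_degree G v = card (nbrs G v)"
proof -
  have "{e \<in> eset G. v \<in> e} = (\<lambda>w. {v, w}) ` nbrs G v"
    using assms by (auto simp: nbrs_def graph_adj_def simple_graph_def elim!: edge_other_end)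
  moreover have "inj_on (\<lambda>w. {v, w}) (nbrs G v)"
    by (auto simp: inj_on_def doubleton_eq_iff)
  ultimately show ?thesis by (simp add: vertex_degree_def card_image)
qed

lemma vertex_degree_le: "simple_graph G \<Longrightarrow> v \<in> vset G \<Longrightarrow> vertex_degree G v \<le> card (vset G) - 1"
  using card_mono[OF _ nbrs_subset[of G v]]
  by (simp add: vertex_degree_eq_card_nbrs simple_graph_def)

text \<open>
  Summing degrees over \<open>S\<close> counts an edge once for each end in \<open>S\<close>: edges inside \<open>S\<close> are counted
  twice and edges avoiding \<open>S\<close> not at all.
\<close>

lemma edge_count:
  assumes "simple_graph G" "S \<subseteq> vset G"
  shows "card (eset G) + card {e \<in> eset G. e \<subseteq> S} =
         card {e \<in> eset G. e \<inter> S = {}} + (\<Sum>x\<in>S. vertex_degree G x)"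
proof -
  let ?E = "eset G"
  have fE: "finite ?E" by (rule finite_eset[OF assms(1)])
  have fS: "finite S" using assms by (auto simp: simple_graph_def intro: finite_subset)
  have "(\<Sum>x\<in>S. vertex_degree G x) = (\<Sum>x\<in>S. \<Sum>e\<in>?E. of_bool (x \<in> e))"
    using fE by (simp add: vertex_degree_def Collect_conj_eq Int_commute)
  also have "\<dots> = (\<Sum>e\<in>?E. \<Sum>x\<in>S. of_bool (x \<in> e))" by (rule sum.swap)
  also have "\<dots> = (\<Sum>e\<in>?E. card (e \<inter> S))" using fS by (simp add: Int_commute)
  finally have deg: "(\<Sum>x\<in>S. vertex_degree G x) = (\<Sum>e\<in>?E. card (e \<inter> S))" .
  have "(\<Sum>e\<in>?E. 1 + of_bool (e \<subseteq> S)) = (\<Sum>e\<in>?E. of_bool (e \<inter> S = {}) + card (e \<inter> S))"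
  proof (rule sum.cong[OF refl])
    fix e assume "e \<in> ?E"
    then have "card e = 2" using assms by (auto simp: simple_graph_def)
    then obtain a b where "e = {a, b}" "a \<noteq> b" by (auto simp: card_2_iff)
    then show "1 + of_bool (e \<subseteq> S) = of_bool (e \<inter> S = {}) + card (e \<inter> S)"
      by (auto simp: Int_insert_left)
  qed
  then show ?thesis using fE by (simp add: deg sum.distrib sum_Suc Collect_conj_eq Int_commute)
qed

lemma edge_bound:
  assumes "simple_graph G" "S \<subseteq> vset G"
  shows "card (eset G) + card {e \<in> eset G. e \<subseteq> S} \<le>
         (card (vset G - S) choose 2) + (\<Sum>x\<in>S. vertex_degree G x)"
proof -
  have "{e \<in> eset G. e \<inter> S = {}} \<subseteq> {e. e \<subseteq> vset G - S \<and> card e = 2}"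
    using assms by (auto simp: simple_graph_def)
  moreover have "finite (vset G)" using assms by (simp add: simple_graph_def)
  ultimately have "card {e \<in> eset G. e \<inter> S = {}} \<le> (card (vset G - S) choose 2)"
    using card_mono[of "{e. e \<subseteq> vset G - S \<and> card e = 2}"] n_subsets[of "vset G - S" 2] by fastforce
  then show ?thesis using edge_count[OF assms] by simp
qed

lemma handshake:
  assumes "simple_graph G"
  shows "2 * card (eset G) = (\<Sum>x\<in>vset G. vertex_degree G x)"
proof -
  have "{e \<in> eset G. e \<inter> vset G = {}} = {}" "{e \<in> eset G. e \<subseteq> vset G} = eset G"
    using assms by (auto simp: simple_graph_def Int_absorb2)
  then show ?thesis using edge_count[OF assms subset_refl] by (simp only: card.empty)
qed

section \<open>Hamilton paths and degree sums\<close>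

text \<open>
  The move known as 2-opt: the segment of the path from position \<open>l + 1\<close> to position \<open>r\<close> is
  reversed. Only the two steps leaving positions \<open>l\<close> and \<open>r\<close> disappear, so nothing is assumed of them.
\<close>

lemma two_opt:
  assumes sym: "\<And>x y. R x y \<Longrightarrow> R y x"
    and "l < r" "Suc r < length P" and dist: "distinct P"
    and step: "\<And>i. Suc i < length P \<Longrightarrow> i \<noteq> l \<Longrightarrow> i \<noteq> r \<Longrightarrow> R (P ! i) (P ! Suc i)"
    and new: "R (P ! l) (P ! r)" "R (P ! Suc l) (P ! Suc r)"
  shows "\<exists>Q. successively R Q \<and> Q \<noteq> [] \<and> hd Q = hd P \<and> last Q = last P \<and> set Q = set P \<and> distinct Q"
proof -
  define X where "X = take (Suc l) P"
  define Y where "Y = take (r - l) (drop (Suc l) P)"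
  define Z where "Z = drop (Suc r) P"
  have YZ: "Y @ Z = drop (Suc l) P"
    unfolding Y_def Z_def using assms(2)
    by (metis add_Suc_right append_take_drop_id drop_drop le_add_diff_inverse2 less_imp_le_nat)
  have P: "P = X @ Y @ Z" by (simp add: YZ) (simp add: X_def)
  have len: "length X = Suc l" "length Y = r - l" "length Z = length P - Suc r"
    using assms by (auto simp: X_def Y_def Z_def)
  then have ne: "X \<noteq> []" "Y \<noteq> []" "Z \<noteq> []" using assms(2,3) by auto
  have X: "successively R X"
    using assms(2,3) len by (auto simp: successively_conv_nth X_def intro!: step)
  have "successively (\<lambda>x y. R y x) Y"
    using assms(2,3) len by (auto simp: successively_conv_nth Y_def intro!: sym[OF step])
  moreover have "successively R Z"
    using assms(2,3) len by (auto simp: successively_conv_nth Z_def intro!: step)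
  moreover have "last X = P ! l" "last Y = P ! r" "hd Y = P ! Suc l" "hd Z = P ! Suc r"
    using assms(2,3) ne len
    by (simp_all add: last_conv_nth hd_conv_nth) (simp_all add: X_def Y_def Z_def)
  ultimately have "successively R (X @ rev Y @ Z)"
    using X ne new by (simp add: successively_append_iff hd_rev last_rev)
  moreover have "distinct (X @ rev Y @ Z)" using dist by (auto simp: P)
  ultimately show ?thesis using ne
    by (intro exI[of _ "X @ rev Y @ Z"]) (simp add: P)
qed

text \<open>
  The pigeonhole step. All neighbours of \<open>P ! i\<close> but at most one, the last vertex, give a position \<open>j\<close>
  with a successor; all neighbours of \<open>P ! Suc i\<close> but at most one, the first vertex, give a position
  \<open>j\<close> preceding them. Neither kind of position can be \<open>i\<close>, so at least \<open>n - 1\<close> choices are made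
  among \<open>n - 2\<close> positions and some \<open>j\<close> is chosen twice.
\<close>

lemma crossing_pair:
  assumes sg: "simple_graph G" and P: "set P = vset G" "distinct P"
    and i: "Suc i < length P"
    and nadj: "\<not> graph_adj G (P ! i) (P ! Suc i)"
    and deg: "card (vset G) < vertex_degree G (P ! i) + vertex_degree G (P ! Suc i)"
  obtains j where "Suc j < length P" "j \<noteq> i" "graph_adj G (P ! i) (P ! j)"
    "graph_adj G (P ! Suc i) (P ! Suc j)"
proof -
  let ?n = "length P" and ?a = "P ! i" and ?b = "P ! Suc i"
  have n: "card (vset G) = ?n" using P by (metis distinct_card)
  define A where "A = {j. Suc j < ?n \<and> graph_adj G ?a (P ! j)}"
  define B where "B = {j. Suc j < ?n \<and> graph_adj G ?b (P ! Suc j)}"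
  have sub: "A \<union> B \<subseteq> {..<?n - 1} - {i}"
    using graph_adjD(3)[OF sg] by (auto simp: A_def B_def)
  have fin: "finite A" "finite B" using finite_subset[OF sub] by auto
  have nb: "\<exists>j < ?n. x = P ! j" if "graph_adj G y x" for x y
    using graph_adjD(2)[OF sg that] P by (metis in_set_conv_nth)
  have "nbrs G ?a \<subseteq> insert (P ! (?n - 1)) ((!) P ` A)"
  proof
    fix x assume x: "x \<in> nbrs G ?a"
    then obtain j where j: "j < ?n" "x = P ! j" using nb by (auto simp: nbrs_def)
    show "x \<in> insert (P ! (?n - 1)) ((!) P ` A)"
    proof (cases "Suc j < ?n")
      case True
      then show ?thesis using x j by (auto simp: A_def nbrs_def)
    next
      case False
      then have "j = ?n - 1" using j(1) by simp
      then show ?thesis using j(2) by simp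
    qed
  qed
  then have "card (nbrs G ?a) \<le> card (insert (P ! (?n - 1)) ((!) P ` A))"
    using fin by (intro card_mono) auto
  also have "\<dots> \<le> Suc (card A)"
    using card_insert_le_m1 card_image_le[OF fin(1), of "(!) P"] by (metis Suc_le_mono card.insert finite_imageI fin(1) insert_absorb le_SucI)
  finally have a: "card (nbrs G ?a) \<le> Suc (card A)" .
  have "nbrs G ?b \<subseteq> insert (P ! 0) ((\<lambda>j. P ! Suc j) ` B)"
  proof
    fix x assume x: "x \<in> nbrs G ?b"
    then obtain j where j: "j < ?n" "x = P ! j" using nb by (auto simp: nbrs_def)
    show "x \<in> insert (P ! 0) ((\<lambda>j. P ! Suc j) ` B)"
      using x j by (cases j) (auto simp: B_def nbrs_def)
  qed
  then have "card (nbrs G ?b) \<le> card (insert (P ! 0) ((\<lambda>j. P ! Suc j) ` B))"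
    using fin by (intro card_mono) auto
  also have "\<dots> \<le> Suc (card B)"
    using card_image_le[OF fin(2), of "\<lambda>j. P ! Suc j"] by (metis Suc_le_mono card.insert finite_imageI fin(2) insert_absorb le_SucI)
  finally have b: "card (nbrs G ?b) \<le> Suc (card B)" .
  have "A \<inter> B \<noteq> {}"
  proof
    assume "A \<inter> B = {}"
    then have "card A + card B = card (A \<union> B)" using fin by (simp add: card_Un_disjoint)
    also have "\<dots> \<le> card ({..<?n - 1} - {i})" using sub by (intro card_mono) auto
    also have "\<dots> = ?n - 2" using i by simp
    finally show False using a b deg n i by (simp add: vertex_degree_eq_card_nbrs[OF sg])
  qed
  then obtain j where "j \<in> A" "j \<in> B" by auto
  moreover from this sub have "j \<noteq> i" by auto
  ultimately show ?thesis using that by (auto simp: A_def B_def)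
qed

text \<open>
  A Hamilton path using the extra edge \<open>uv\<close> is repaired by a 2-opt move at that edge and at a
  crossing pair, which replaces \<open>uv\<close> and one further step by two edges of \<open>G\<close>.
\<close>

lemma hamilton_connected_remove_edge:
  assumes sg: "simple_graph G"
    and nadj: "\<not> graph_adj G u v"
    and deg: "card (vset G) < vertex_degree G u + vertex_degree G v"
    and HC: "hamilton_connected (G\<lparr>eset := insert {u, v} (eset G)\<rparr>)"
  shows "hamilton_connected G"
  unfolding hamilton_connected_def
proof (intro ballI impI)
  let ?R = "graph_adj G" and ?G' = "G\<lparr>eset := insert {u, v} (eset G)\<rparr>"
  fix s t assume "s \<in> vset G" "t \<in> vset G" "s \<noteq> t"
  then obtain P where P: "graph_path ?G' s P t" "set P = vset G"
    using HC unfolding hamilton_connected_def by fastforce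
  then have P': "P \<noteq> []" "hd P = s" "last P = t" "distinct P" "successively (graph_adj ?G') P"
    by (auto simp: graph_path_def)
  have "\<exists>Q. successively ?R Q \<and> Q \<noteq> [] \<and> hd Q = hd P \<and> last Q = last P \<and> set Q = set P \<and> distinct Q"
  proof (cases "successively ?R P")
    case True
    then show ?thesis using P' by blast
  next
    case False
    then obtain i where i: "Suc i < length P" "\<not> ?R (P ! i) (P ! Suc i)"
      by (auto simp: successively_conv_nth)
    have step': "graph_adj ?G' (P ! j) (P ! Suc j)" if "Suc j < length P" for j
      using P'(5) that by (auto simp: successively_conv_nth)
    \<comment> \<open>The extra edge is the only step of the path that is not in \<open>G\<close>.\<close>
    have uv: "{P ! i, P ! Suc i} = {u, v}"
      using step'[OF i(1)] i(2) by (auto simp: graph_adj_def)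
    have step: "?R (P ! j) (P ! Suc j)" if "Suc j < length P" "j \<noteq> i" for j
    proof -
      have "{P ! j, P ! Suc j} \<noteq> {P ! i, P ! Suc i}"
        using that i P'(4) by (auto simp: doubleton_eq_iff nth_eq_iff_index_eq)
      then show ?thesis using step'[OF that(1)] uv by (auto simp: graph_adj_def)
    qed
    have "card (vset G) < vertex_degree G (P ! i) + vertex_degree G (P ! Suc i)"
      using uv deg by (auto simp: doubleton_eq_iff)
    then obtain j where j: "Suc j < length P" "j \<noteq> i" "?R (P ! i) (P ! j)" "?R (P ! Suc i) (P ! Suc j)"
      using crossing_pair[OF sg P(2) P'(4) i] by blast
    have sym: "?R y x" if "?R x y" for x y using that by (simp add: graph_adj_sym)
    show ?thesis
    proof (cases "j < i")
      case True
      show ?thesis by (rule two_opt[of ?R j i P]) (use True i j P'(4) in \<open>auto intro: sym step\<close>)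
    next
      case False
      show ?thesis by (rule two_opt[of ?R i j P]) (use False i j P'(4) in \<open>auto intro: sym step\<close>)
    qed
  qed
  then obtain Q where Q: "successively ?R Q" "Q \<noteq> []" "hd Q = hd P" "last Q = last P" "set Q = set P" "distinct Q"
    by blast
  with P(2) P' show "\<exists>p. graph_path G s p t \<and> set p = vset G"
    by (intro exI[of _ Q]) (auto simp: graph_path_def)
qed

lemma hamilton_connected_complete:
  assumes "finite (vset G)" and "\<And>u v. u \<in> vset G \<Longrightarrow> v \<in> vset G \<Longrightarrow> u \<noteq> v \<Longrightarrow> graph_adj G u v"
  shows "hamilton_connected G"
  unfolding hamilton_connected_def
proof (intro ballI impI)
  fix s t assume st: "s \<in> vset G" "t \<in> vset G" "s \<noteq> t"
  obtain xs where xs: "set xs = vset G - {s, t}" "distinct xs"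
    using finite_distinct_list[of "vset G - {s, t}"] assms(1) by auto
  let ?p = "s # xs @ [t]"
  have dist: "distinct ?p" and set: "set ?p = vset G" using xs st by auto
  have "successively (graph_adj G) ?p"
    unfolding successively_conv_nth
  proof (intro allI impI)
    fix i assume "Suc i < length ?p"
    moreover from this have "?p ! i \<noteq> ?p ! Suc i"
      using nth_eq_iff_index_eq[OF dist, of i "Suc i"] by simp
    ultimately show "graph_adj G (?p ! i) (?p ! Suc i)"
      using assms(2) set by (metis Suc_lessD nth_mem)
  qed
  then show "\<exists>p. graph_path G s p t \<and> set p = vset G"
    using dist set by (intro exI[of _ ?p]) (auto simp: graph_path_def)
qed

text \<open>
  Being equal to one's closure in the sense of Bondy and Chvatal, for the threshold \<open>n + 1\<close> that
  belongs to Hamilton-connectedness.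
\<close>

definition ore_closed :: "'a sgraph \<Rightarrow> bool" where
  "ore_closed G \<longleftrightarrow> (\<forall>u \<in> vset G. \<forall>v \<in> vset G. u \<noteq> v \<and> \<not> graph_adj G u v \<longrightarrow>
     vertex_degree G u + vertex_degree G v \<le> card (vset G))"

lemma maximal_extension:
  assumes sg: "simple_graph G" and nHC: "\<not> hamilton_connected G"
  obtains H where "simple_graph H" "vset H = vset G" "eset G \<subseteq> eset H" "ore_closed H"
    "\<exists>u \<in> vset H. \<exists>v \<in> vset H. u \<noteq> v \<and> \<not> graph_adj H u v"
proof -
  let ?K = "{e. e \<subseteq> vset G \<and> card e = 2}"
  define \<A> where "\<A> = {E. eset G \<subseteq> E \<and> E \<subseteq> ?K \<and> \<not> hamilton_connected (G\<lparr>eset := E\<rparr>)}"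
  have fin: "finite (vset G)" using sg by (simp add: simple_graph_def)
  then have "finite \<A>" by (intro finite_subset[of \<A> "Pow ?K"]) (auto simp: \<A>_def)
  moreover have "eset G \<in> \<A>" using sg nHC by (auto simp: \<A>_def simple_graph_def)
  ultimately obtain E where E: "E \<in> \<A>" "\<And>E'. E' \<in> \<A> \<Longrightarrow> E \<subseteq> E' \<Longrightarrow> E = E'"
    by (metis finite_has_maximal empty_iff)
  define H where "H = G\<lparr>eset := E\<rparr>"
  have H: "vset H = vset G" "eset H = E" "simple_graph H" "eset G \<subseteq> E" "\<not> hamilton_connected H"
    using E(1) fin by (auto simp: H_def \<A>_def simple_graph_def)
  have "ore_closed H"
    unfolding ore_closed_def
  proof (intro ballI impI)
    fix u v assume uv: "u \<in> vset H" "v \<in> vset H" "u \<noteq> v \<and> \<not> graph_adj H u v"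
    then have "insert {u, v} E \<notin> \<A>" using E(2)[of "insert {u, v} E"] H by (auto simp: graph_adj_def)
    then have "hamilton_connected (H\<lparr>eset := insert {u, v} (eset H)\<rparr>)"
      using E(1) uv H(1) by (auto simp: \<A>_def H_def)
    then show "vertex_degree H u + vertex_degree H v \<le> card (vset H)"
      using hamilton_connected_remove_edge[OF H(3)] uv H(5) by (meson not_le)
  qed
  moreover have "\<exists>u \<in> vset H. \<exists>v \<in> vset H. u \<noteq> v \<and> \<not> graph_adj H u v"
    using hamilton_connected_complete[of H] H(1,5) fin by auto
  ultimately show ?thesis using that H by metis
qed

section \<open>A set of vertices of low degree\<close>

text \<open>
  Let \<open>u, v\<close> be a nonadjacent pair with maximal degree sum, \<open>u\<close> being the end of smaller degree. Every
  vertex \<open>x\<close> not adjacent to \<open>v\<close> competes with \<open>u\<close> in the pair \<open>x, v\<close>, so its degree is at most that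
  of \<open>u\<close>. Closedness makes the degree of \<open>v\<close> at most \<open>n\<close> minus that of \<open>u\<close>, so there are enough such
  vertices.
\<close>

lemma low_degree_set:
  assumes sg: "simple_graph G" and oc: "ore_closed G"
    and nc: "\<exists>u \<in> vset G. \<exists>v \<in> vset G. u \<noteq> v \<and> \<not> graph_adj G u v"
  obtains u L where "u \<in> vset G" "L \<subseteq> vset G" "card L = vertex_degree G u - 1"
    "2 * vertex_degree G u \<le> card (vset G)" "\<And>x. x \<in> L \<Longrightarrow> vertex_degree G x \<le> vertex_degree G u"
proof -
  let ?d = "vertex_degree G" and ?V = "vset G"
  define N where "N = {(u, v). u \<in> ?V \<and> v \<in> ?V \<and> u \<noteq> v \<and> \<not> graph_adj G u v}"
  let ?s = "\<lambda>(u, v). ?d u + ?d v"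
  have fin: "finite ?V" using sg by (simp add: simple_graph_def)
  then have "finite N" by (intro finite_subset[of N "?V \<times> ?V"]) (auto simp: N_def)
  moreover have "N \<noteq> {}" using nc by (auto simp: N_def)
  ultimately obtain p where p: "p \<in> N" "\<And>q. q \<in> N \<Longrightarrow> ?s q \<le> ?s p"
    using finite_has_maximal[of "?s ` N"] by (fastforce simp: not_le[symmetric])
  obtain a b where ab: "(a, b) \<in> N" "\<And>x y. (x, y) \<in> N \<Longrightarrow> ?d x + ?d y \<le> ?d a + ?d b"
    using p by (cases p) fastforce
  \<comment> \<open>The relation is symmetric, so the maximal pair can be ordered by degree.\<close>
  obtain u v where uv: "(u, v) \<in> N" "\<And>x y. (x, y) \<in> N \<Longrightarrow> ?d x + ?d y \<le> ?d u + ?d v" "?d u \<le> ?d v"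
  proof (cases "?d a \<le> ?d b")
    case True
    then show ?thesis using that ab by blast
  next
    case False
    have "(b, a) \<in> N" using ab(1) by (auto simp: N_def graph_adj_sym)
    then show ?thesis using that[of b a] ab False by (simp add: add.commute)
  qed
  have sum: "?d u + ?d v \<le> card ?V" using uv(1) oc by (auto simp: N_def ore_closed_def)
  define A where "A = ?V - insert v (nbrs G v)"
  have "card A = card ?V - Suc (?d v)"
  proof -
    have "insert v (nbrs G v) \<subseteq> ?V" "v \<notin> nbrs G v"
      using nbrs_subset[OF sg, of v] uv(1) by (auto simp: N_def)
    then show ?thesis using finite_nbrs[OF sg, of v]
      by (simp add: A_def card_Diff_subset vertex_degree_eq_card_nbrs[OF sg])
  qed
  then have "?d u - 1 \<le> card A" using sum by simp
  then obtain L where L: "L \<subseteq> A" "card L = ?d u - 1" by (rule obtain_subset_with_card_n)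
  have "?d x \<le> ?d u" if "x \<in> L" for x
  proof -
    have "(x, v) \<in> N" using that L(1) uv(1) by (auto simp: A_def N_def nbrs_def graph_adj_sym)
    from uv(2)[OF this] show ?thesis by simp
  qed
  moreover have "u \<in> ?V" "L \<subseteq> ?V" using uv(1) L(1) by (auto simp: N_def A_def)
  ultimately show ?thesis using that[of u L] L(2) sum uv(3) by simp
qed

lemma choose_two_int: "2 * int (N choose 2) = int N * (int N - 1)"
proof (induction N)
  case (Suc N)
  have "Suc N choose 2 = N + (N choose 2)"
    by (simp add: numeral_2_eq_2)
  then show ?case using Suc by (simp add: algebra_simps)
qed simp

text \<open>
  With \<open>a = n\<close> and \<open>b = k\<close> the inequality between binomial coefficients is linear in \<open>a\<close>:
  \<open>2 * a * (b - 4) \<le> 3 * b * b - 3 * b - 38\<close>. It fails for \<open>b = 4\<close>, and for larger \<open>b\<close> it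
  conflicts with \<open>2 * b \<le> a\<close> unless \<open>b\<close> is at most \<open>8\<close>.
\<close>

lemma critical_parameters:
  fixes n k :: nat
  assumes "3 \<le> k" "2 * k \<le> n" "11 \<le> n"
    and le: "((n - 3) choose 2) + 13 \<le> ((n - (k - 1)) choose 2) + (k - 1) * k"
  shows "k = 3 \<or> (n, k) \<in> {(11, 5), (12, 6), (13, 6), (14, 7), (16, 8)}"
proof -
  define a b where "a = int n" and "b = int k"
  have "2 * int ((n - 3) choose 2) + 26 \<le> 2 * int ((n - (k - 1)) choose 2) + 2 * int ((k - 1) * k)"
    using le by linarith
  moreover have "int (n - 3) = a - 3" "int (n - (k - 1)) = a - b + 1" "int ((k - 1) * k) = (b - 1) * b"
    using assms by (auto simp: a_def b_def of_nat_diff)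
  ultimately have "(a - 3) * (a - 4) + 26 \<le> (a - b + 1) * (a - b) + 2 * ((b - 1) * b)"
    by (simp add: choose_two_int)
  then have *: "2 * a * (b - 4) \<le> 3 * b * b - 3 * b - 38" by (simp add: algebra_simps)
  have ab: "3 \<le> b" "2 * b \<le> a" "11 \<le> a" using assms by (auto simp: a_def b_def)
  have "b < 9"
  proof (rule ccontr)
    assume "\<not> b < 9"
    then have "2 * (2 * b) * (b - 4) \<le> 2 * a * (b - 4)" using ab by (intro mult_right_mono) auto
    then have "(b - 4) * (b - 9) + 2 \<le> 0" using * by (simp add: algebra_simps)
    moreover have "0 \<le> (b - 4) * (b - 9)" using \<open>\<not> b < 9\<close> by simp
    ultimately show False by simp
  qed
  \<comment> \<open>For each of these values the inequality is linear in \<open>a\<close>.\<close>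
  then have "b \<in> {3, 4, 5, 6, 7, 8}" using ab by auto
  then have "b = 3 \<or> (a, b) \<in> {(11, 5), (12, 6), (13, 6), (14, 7), (16, 8)}"
    using * ab by auto
  then show ?thesis by (auto simp: a_def b_def)
qed

section \<open>Structure of the closed graphs with many edges\<close>

text \<open>
  A nonadjacent pair \<open>w, z\<close> outside \<open>L\<close> has degree sum at most \<open>n\<close> and so costs too many edges. For
  \<open>k = 3\<close> it is enough that at most \<open>n + 6\<close> edges meet \<open>L \<union> {w, z}\<close>. For \<open>k \<ge> 5\<close>
  this estimate is too weak, and the sum of all degrees is used: vertices other than those of \<open>L\<close> and
  \<open>w, z\<close> contribute at most \<open>n - 1\<close> each, which falls short of twice the number of edges for every
  sporadic pair.
\<close>

lemma dense_part_complete: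
  fixes n k :: nat
  assumes sg: "simple_graph G" and oc: "ore_closed G"
    and n: "n = card (vset G)" "11 \<le> n" and m: "((n - 3) choose 2) + 13 \<le> card (eset G)"
    and k: "k = 3 \<or> (n, k) \<in> {(11, 5), (12, 6), (13, 6), (14, 7), (16, 8)}"
    and L: "L \<subseteq> vset G" "card L = k - 1" "\<And>x. x \<in> L \<Longrightarrow> vertex_degree G x \<le> k"
    and wz: "w \<in> vset G - L" "z \<in> vset G - L" "w \<noteq> z"
  shows "graph_adj G w z"
proof (rule ccontr)
  assume "\<not> graph_adj G w z"
  then have wzdeg: "vertex_degree G w + vertex_degree G z \<le> n"
    using oc wz n(1) by (auto simp: ore_closed_def)
  have fV: "finite (vset G)" using sg by (simp add: simple_graph_def)
  then have fL: "finite L" using L(1) finite_subset by blast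
  define S where "S = insert w (insert z L)"
  have S: "S \<subseteq> vset G" "finite S" "card S = k + 1"
    using wz L(1,2) fL k by (auto simp: S_def)
  have Ldeg: "(\<Sum>x\<in>L. vertex_degree G x) \<le> (k - 1) * k"
    using sum_bounded_above[of L "vertex_degree G" k] L(2,3) by simp
  have Sdeg: "(\<Sum>x\<in>S. vertex_degree G x) \<le> (k - 1) * k + n"
    using wz fL Ldeg wzdeg by (auto simp: S_def)
  show False
  proof (cases "k = 3")
    case True
    have "card (eset G) \<le> (card (vset G - S) choose 2) + (\<Sum>x\<in>S. vertex_degree G x)"
      using edge_bound[OF sg S(1)] by simp
    also have "card (vset G - S) = n - 4"
      using S True n by (simp add: card_Diff_subset)
    finally have "card (eset G) \<le> ((n - 4) choose 2) + 6 + n"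
      using Sdeg True by simp
    moreover have "((n - 3) choose 2) = (n - 4) + ((n - 4) choose 2)"
    proof -
      have "n - 3 = Suc (n - 4)" using n(2) by simp
      then show ?thesis by (simp add: numeral_2_eq_2)
    qed
    ultimately show False using m n(2) by simp
  next
    case False
    have "2 * card (eset G) = (\<Sum>x\<in>S. vertex_degree G x) + (\<Sum>x\<in>vset G - S. vertex_degree G x)"
      using handshake[OF sg] sum.subset_diff[OF S(1) fV, of "vertex_degree G"] by simp
    also have "(\<Sum>x\<in>vset G - S. vertex_degree G x) \<le> (n - (k + 1)) * (n - 1)"
      using sum_bounded_above[of "vset G - S" "vertex_degree G" "n - 1"] vertex_degree_le[OF sg] S n
      by (simp add: card_Diff_subset)
    finally have "2 * card (eset G) \<le> (k - 1) * k + n + (n - (k + 1)) * (n - 1)"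
      using Sdeg by simp
    then show False using m k False by (auto simp: choose_two)
  qed
qed

text \<open>
  Call \<open>k - vertex_degree G x\<close> the deficit of \<open>x \<in> L\<close>, and let \<open>l\<close> be the number of neighbours of \<open>w\<close>
  in \<open>L\<close>. As \<open>w\<close> sees the whole clique outside \<open>L\<close>, its degree is \<open>n - k + l\<close>, and closedness says that
  \<open>l\<close> is at most the deficit of every \<open>x \<in> L\<close> that \<open>w\<close> misses. If \<open>l\<close> is positive, then \<open>w\<close> misses at
  most as many vertices as the total deficit, so \<open>l\<close> is at least \<open>k - 1\<close> minus the total deficit. If
  \<open>w\<close> misses any vertex at all, then \<open>l\<close> is also at most the total deficit. The two bounds contradict
  each other when the total deficit is less than half of \<open>k - 1\<close>.
\<close>

lemma common_neighbourhood:
  fixes n k :: nat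
  assumes sg: "simple_graph G" and oc: "ore_closed G" and n: "n = card (vset G)"
    and k: "1 \<le> k" "k \<le> n"
    and L: "L \<subseteq> vset G" "card L = k - 1" "\<And>x. x \<in> L \<Longrightarrow> vertex_degree G x \<le> k"
    and D: "\<And>w z. w \<in> vset G - L \<Longrightarrow> z \<in> vset G - L \<Longrightarrow> w \<noteq> z \<Longrightarrow> graph_adj G w z"
    and small: "2 * (\<Sum>x\<in>L. k - vertex_degree G x) < k - 1"
    and w: "w \<in> vset G - L" and y: "y \<in> L" "graph_adj G w y" and x: "x \<in> L"
  shows "graph_adj G w x"
proof (rule ccontr)
  assume nadj: "\<not> graph_adj G w x"
  let ?def = "\<lambda>x. k - vertex_degree G x"
  have fV: "finite (vset G)" using sg by (simp add: simple_graph_def)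
  then have fL: "finite L" using L(1) finite_subset by blast
  define l where "l = card (nbrs G w \<inter> L)"
  have "nbrs G w = (vset G - L - {w}) \<union> (nbrs G w \<inter> L)"
    using D w nbrs_subset[OF sg, of w] by (auto simp: nbrs_def)
  moreover have "card ((vset G - L - {w}) \<union> (nbrs G w \<inter> L)) = card (vset G - L - {w}) + l"
    unfolding l_def using fV fL by (intro card_Un_disjoint) auto
  moreover have "card (vset G - L - {w}) = n - k"
    using w fL L(1,2) n k by (simp add: card_Diff_subset)
  ultimately have dw: "vertex_degree G w = n - k + l"
    using vertex_degree_eq_card_nbrs[OF sg] by metis
  have bound: "l \<le> ?def x'" if "x' \<in> L" "\<not> graph_adj G w x'" for x'
  proof -
    have "w \<in> vset G" "x' \<in> vset G" "w \<noteq> x'" using that(1) w L(1) by auto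
    then have "vertex_degree G w + vertex_degree G x' \<le> n"
      using oc that(2) n by (simp add: ore_closed_def)
    then show ?thesis using dw k by simp
  qed
  have "l > 0" using y fL by (auto simp: l_def nbrs_def card_gt_0_iff)
  have "card (L - nbrs G w) = (\<Sum>x'\<in>L - nbrs G w. 1)" by simp
  also have "\<dots> \<le> (\<Sum>x'\<in>L - nbrs G w. ?def x')"
    using bound \<open>l > 0\<close> by (intro sum_mono) (fastforce simp: nbrs_def)
  also have "\<dots> \<le> (\<Sum>x'\<in>L. ?def x')" using fL by (intro sum_mono2) auto
  finally have "card (L - nbrs G w) \<le> (\<Sum>x'\<in>L. ?def x')" .
  moreover have "card (L - nbrs G w) = k - 1 - l"
    using fL L(2) by (metis card_Diff_subset_Int finite_Int inf_commute l_def)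
  moreover have "l \<le> (\<Sum>x'\<in>L. ?def x')"
    using bound[OF x nadj] member_le_sum[OF x, of ?def] fL by simp
  ultimately show False using small by linarith
qed

text \<open>
  The edge count leaves a budget shared by the deficits and the edges inside \<open>L\<close>. If \<open>C\<close> has fewer than
  \<open>k\<close> elements, every vertex of \<open>L\<close> has a deficit or a neighbour in \<open>L\<close>, which for \<open>k \<noteq> 3\<close> costs more than
  the budget. For \<open>k = 3\<close> the minimum degree excludes deficits, and the two vertices of \<open>L\<close> can only
  make up for a missing vertex of \<open>C\<close> by being adjacent.
\<close>

lemma closed_graph_structure:
  fixes n k :: nat
  assumes sg: "simple_graph G" and oc: "ore_closed G"
    and n: "n = card (vset G)" "11 \<le> n" and m: "((n - 3) choose 2) + 13 \<le> card (eset G)"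
    and mind: "\<And>x. x \<in> vset G \<Longrightarrow> 3 \<le> vertex_degree G x"
    and k: "k = 3 \<or> (n, k) \<in> {(11, 5), (12, 6), (13, 6), (14, 7), (16, 8)}"
    and L: "L \<subseteq> vset G" "card L = k - 1" "\<And>x. x \<in> L \<Longrightarrow> vertex_degree G x \<le> k"
  obtains C where "C \<subseteq> vset G - L"
    "\<And>w z. w \<in> vset G - L \<Longrightarrow> z \<in> vset G - L \<Longrightarrow> w \<noteq> z \<Longrightarrow> graph_adj G w z"
    "\<And>w x. w \<in> vset G - L \<Longrightarrow> x \<in> L \<Longrightarrow> graph_adj G w x \<longleftrightarrow> w \<in> C"
    "(card C = k \<and> (\<forall>x\<in>L. \<forall>y\<in>L. \<not> graph_adj G x y)) \<or>
     (k = 3 \<and> card C = 2 \<and> (\<forall>x\<in>L. \<forall>y\<in>L. x \<noteq> y \<longrightarrow> graph_adj G x y))"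
proof -
  have fV: "finite (vset G)" using sg by (simp add: simple_graph_def)
  then have fL: "finite L" using L(1) finite_subset by blast
  let ?d = "vertex_degree G"
  let ?def = "\<lambda>x. k - ?d x"
  define eL where "eL = card {e \<in> eset G. e \<subseteq> L}"
  have k': "3 \<le> k" "k \<le> n" using k n by auto
  have cD: "card (vset G - L) = n - (k - 1)"
    using L(1,2) fL n(1) by (simp add: card_Diff_subset)
  have D: "graph_adj G w z" if "w \<in> vset G - L" "z \<in> vset G - L" "w \<noteq> z" for w z
    using dense_part_complete[OF sg oc n m k L that] by simp
  have "(\<Sum>x\<in>L. ?d x) + (\<Sum>x\<in>L. ?def x) = (\<Sum>x\<in>L. k)"
    unfolding sum.distrib[symmetric] using L(3) by (intro sum.cong) auto
  then have defsum: "(\<Sum>x\<in>L. ?d x) + (\<Sum>x\<in>L. ?def x) = (k - 1) * k" using L(2) by simp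
  have count: "card (eset G) + eL + (\<Sum>x\<in>L. ?def x) \<le> ((n - (k - 1)) choose 2) + (k - 1) * k"
    using edge_bound[OF sg L(1)] defsum cD by (simp add: eL_def)
  \<comment> \<open>In the sporadic cases the right-hand side of the count exceeds the number of edges by at most 2, and for \<open>k = 5\<close> not at all.\<close>
  have budget: "2 * (\<Sum>x\<in>L. ?def x) + 2 * eL < k - 1" if "k \<noteq> 3"
    using count m k that by (auto simp: choose_two)
  have small: "2 * (\<Sum>x\<in>L. ?def x) < k - 1"
  proof (cases "k = 3")
    case True
    then have "?def x = 0" if "x \<in> L" for x using mind[of x] that L(1) by auto
    then show ?thesis using True by simp
  qed (use budget in simp)
  have "L \<noteq> {}" using L(2) k' by auto
  then obtain x0 where x0: "x0 \<in> L" by auto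
  define C where "C = nbrs G x0 - L"
  have CV: "C \<subseteq> vset G - L" using nbrs_subset[OF sg] by (auto simp: C_def)
  have C: "graph_adj G w x \<longleftrightarrow> w \<in> C" if "w \<in> vset G - L" "x \<in> L" for w x
  proof -
    have "w \<in> C \<longleftrightarrow> graph_adj G w x0"
      using that(1) graph_adj_sym[of G w x0] by (simp add: C_def nbrs_def)
    moreover have "graph_adj G w y" if "graph_adj G w z" "z \<in> L" "y \<in> L" for y z
      using common_neighbourhood[OF sg oc n(1) _ k'(2) L D small \<open>w \<in> vset G - L\<close> that(2,1,3)] k'(1)
      by linarith
    ultimately show ?thesis using that(2) x0 by blast
  qed
  have fC: "finite C" using CV fV finite_subset by blast
  have deg: "?d x = card C + card (nbrs G x \<inter> L)" if "x \<in> L" for x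
  proof -
    have "nbrs G x = C \<union> (nbrs G x \<inter> L)"
    proof (rule set_eqI)
      fix w show "w \<in> nbrs G x \<longleftrightarrow> w \<in> C \<union> (nbrs G x \<inter> L)"
        using C[OF _ that, of w] CV nbrs_subset[OF sg, of x] graph_adj_sym[of G w x]
        by (cases "w \<in> L") (auto simp: nbrs_def)
    qed
    moreover have "card (C \<union> (nbrs G x \<inter> L)) = card C + card (nbrs G x \<inter> L)"
      using fC fL CV by (intro card_Un_disjoint) auto
    ultimately show ?thesis using vertex_degree_eq_card_nbrs[OF sg] by metis
  qed
  have Ck: "card C \<le> k" using deg[OF x0] L(3)[OF x0] by simp
  have "(card C = k \<and> (\<forall>x\<in>L. \<forall>y\<in>L. \<not> graph_adj G x y)) \<or>
     (k = 3 \<and> card C = 2 \<and> (\<forall>x\<in>L. \<forall>y\<in>L. x \<noteq> y \<longrightarrow> graph_adj G x y))"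
  proof (cases "card C = k")
    case True
    have "\<not> graph_adj G x y" if "x \<in> L" "y \<in> L" for x y
    proof -
      have "nbrs G x \<inter> L = {}" using deg[OF that(1)] L(3)[OF that(1)] True fL by simp
      then show ?thesis using that by (auto simp: nbrs_def)
    qed
    then show ?thesis using True by simp
  next
    case False
    then have Clt: "card C < k" using Ck by simp
    have "k = 3"
    proof (rule ccontr)
      assume "k \<noteq> 3"
      \<comment> \<open>The handshake lemma in the subgraph induced by \<open>L\<close>.\<close>
      have "(\<Sum>x\<in>L. card {e \<in> eset G. e \<subseteq> L \<and> x \<in> e}) = 2 * eL"
      proof -
        have "simple_graph \<lparr>vset = L, eset = {e \<in> eset G. e \<subseteq> L}\<rparr>"
          using sg fL by (auto simp: simple_graph_def)
        from handshake[OF this] show ?thesis by (simp add: vertex_degree_def eL_def conj_assoc)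
      qed
      moreover have "1 \<le> ?def x + card {e \<in> eset G. e \<subseteq> L \<and> x \<in> e}" if "x \<in> L" for x
      proof (cases "nbrs G x \<inter> L = {}")
        case True
        then show ?thesis using deg[OF that] Clt by simp
      next
        case False
        then obtain y where "{x, y} \<in> eset G" "y \<in> L" by (auto simp: nbrs_def graph_adj_def)
        then have "{x, y} \<in> {e \<in> eset G. e \<subseteq> L \<and> x \<in> e}" using that by simp
        then have "{e \<in> eset G. e \<subseteq> L \<and> x \<in> e} \<noteq> {}" by blast
        then have "0 < card {e \<in> eset G. e \<subseteq> L \<and> x \<in> e}"
          using finite_eset[OF sg] by (simp add: card_gt_0_iff)
        then show ?thesis by simp
      qed
      then have "(\<Sum>x\<in>L. 1) \<le> (\<Sum>x\<in>L. ?def x + card {e \<in> eset G. e \<subseteq> L \<and> x \<in> e})"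
        by (intro sum_mono) auto
      ultimately show False using budget[OF \<open>k \<noteq> 3\<close>] L(2) by (simp add: sum.distrib)
    qed
    have L1: "nbrs G x \<inter> L \<subseteq> L - {x}" for x using nbrs_subset[OF sg, of x] by auto
    have c1: "card (nbrs G x \<inter> L) \<ge> 3 - card C" if "x \<in> L" for x
      using mind[of x] deg[OF that] L(1) that by auto
    have eq: "nbrs G x \<inter> L = L - {x}" if "x \<in> L" for x
      using c1[OF that] Clt L(2) \<open>k = 3\<close> that fL
      by (intro card_subset_eq[OF _ L1]) (auto intro!: antisym card_mono[OF _ L1, THEN order_trans])
    then have "graph_adj G x y" if "x \<in> L" "y \<in> L" "x \<noteq> y" for x y
      using that by (auto simp: nbrs_def)
    moreover have "card C = 2"
      using eq[OF x0] c1[OF x0] L(2) x0 \<open>k = 3\<close> fL Clt by simp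
    ultimately show ?thesis using \<open>k = 3\<close> by simp
  qed
  then show ?thesis using that[OF CV D C] by blast
qed

section \<open>The extremal graphs and isomorphism\<close>

lemma vset_ops [simp]:
  "vset (complete_graph n) = {..<n}"
  "vset (disjoint_union G H) = vset G <+> vset H"
  "vset (graph_join G H) = vset G <+> vset H"
  "vset (graph_copies k G) = {..<k} \<times> vset G"
  by (simp_all add: complete_graph_def disjoint_union_def graph_join_def graph_copies_def)

lemma image_doubleton_iff:
  assumes "inj f"
  shows "{f u, f v} \<in> (`) f ` E \<longleftrightarrow> {u, v} \<in> E"
proof
  assume "{f u, f v} \<in> (`) f ` E"
  then obtain e where "e \<in> E" "f ` {u, v} = f ` e" by auto
  then show "{u, v} \<in> E" using inj_image_eq_iff[OF assms] by metis
next
  assume "{u, v} \<in> E"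
  then have "f ` {u, v} \<in> (`) f ` E" by (rule imageI)
  then show "{f u, f v} \<in> (`) f ` E" by simp
qed

lemma adj_complete [simp]:
  "graph_adj (complete_graph n) u v \<longleftrightarrow> u < n \<and> v < n \<and> u \<noteq> v"
  by (auto simp: graph_adj_def complete_graph_def card_insert_if)

lemma adj_disjoint_union [simp]:
  "graph_adj (disjoint_union G H) (Inl u) (Inl v) \<longleftrightarrow> graph_adj G u v"
  "graph_adj (disjoint_union G H) (Inr w) (Inr z) \<longleftrightarrow> graph_adj H w z"
  "\<not> graph_adj (disjoint_union G H) (Inl u) (Inr z)"
  "\<not> graph_adj (disjoint_union G H) (Inr w) (Inl v)"
proof -
  let ?E = "((`) Inl ` eset G \<union> (`) Inr ` eset H)"
  have l: "{Inl u, x} \<notin> (`) Inr ` eset H" and r: "{Inr w, y} \<notin> (`) Inl ` eset G"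
    for u :: 'a and w :: 'b and x y by auto
  have E: "eset (disjoint_union G H) = ?E" by (simp add: disjoint_union_def)
  show "graph_adj (disjoint_union G H) (Inl u) (Inl v) \<longleftrightarrow> graph_adj G u v"
    using l[of u "Inl v"] image_doubleton_iff[of Inl u v "eset G"] by (simp add: graph_adj_def E)
  show "graph_adj (disjoint_union G H) (Inr w) (Inr z) \<longleftrightarrow> graph_adj H w z"
    using r[of w "Inr z"] image_doubleton_iff[of Inr w z "eset H"] by (simp add: graph_adj_def E)
  have "{Inl u, Inr z} \<notin> ?E" for u z
    using l[of u "Inr z"] r[of z "Inl u"] by (simp add: insert_commute)
  then show "\<not> graph_adj (disjoint_union G H) (Inl u) (Inr z)"
    "\<not> graph_adj (disjoint_union G H) (Inr w) (Inl v)"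
    by (simp_all add: graph_adj_def E insert_commute)
qed

lemma adj_join [simp]:
  "graph_adj (graph_join G H) (Inl u) (Inl v) \<longleftrightarrow> graph_adj G u v"
  "graph_adj (graph_join G H) (Inr w) (Inr z) \<longleftrightarrow> graph_adj H w z"
  "graph_adj (graph_join G H) (Inl u) (Inr z) \<longleftrightarrow> u \<in> vset G \<and> z \<in> vset H"
  "graph_adj (graph_join G H) (Inr w) (Inl v) \<longleftrightarrow> v \<in> vset G \<and> w \<in> vset H"
proof -
  have *: "graph_adj (graph_join G H) x y \<longleftrightarrow> graph_adj (disjoint_union G H) x y
      \<or> {x, y} \<in> {{Inl u, Inr v} | u v. u \<in> vset G \<and> v \<in> vset H}" for x y
    by (simp add: graph_adj_def graph_join_def)
  show
    "graph_adj (graph_join G H) (Inl u) (Inl v) \<longleftrightarrow> graph_adj G u v"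
    "graph_adj (graph_join G H) (Inr w) (Inr z) \<longleftrightarrow> graph_adj H w z"
    "graph_adj (graph_join G H) (Inl u) (Inr z) \<longleftrightarrow> u \<in> vset G \<and> z \<in> vset H"
    "graph_adj (graph_join G H) (Inr w) (Inl v) \<longleftrightarrow> v \<in> vset G \<and> w \<in> vset H"
    unfolding * by (auto simp: doubleton_eq_iff)
qed

lemma adj_copies_complete1 [simp]: "\<not> graph_adj (graph_copies k (complete_graph (Suc 0))) x y"
proof -
  have "eset (complete_graph (Suc 0)) = {}"
    by (auto simp: complete_graph_def lessThan_Suc subset_singleton_iff)
  then show ?thesis by (simp add: graph_adj_def graph_copies_def)
qed

lemma simple_complete_graph: "simple_graph (complete_graph n)"
  by (auto simp: simple_graph_def complete_graph_def)

lemma simple_graph_copies: "simple_graph G \<Longrightarrow> simple_graph (graph_copies k G)"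
  by (auto simp: simple_graph_def graph_copies_def card_image inj_on_def)

lemma simple_disjoint_union:
  "simple_graph G \<Longrightarrow> simple_graph H \<Longrightarrow> simple_graph (disjoint_union G H)"
  by (auto simp: simple_graph_def disjoint_union_def card_image)

lemma simple_graph_join:
  assumes "simple_graph G" "simple_graph H"
  shows "simple_graph (graph_join G H)"
proof -
  have "simple_graph (disjoint_union G H)" by (rule simple_disjoint_union[OF assms])
  then show ?thesis by (auto simp: simple_graph_def graph_join_def)
qed

lemma simple_S_graph: "simple_graph (S_graph n k)"
  by (simp add: S_graph_def simple_graph_join simple_disjoint_union simple_complete_graph
      simple_graph_copies)

lemma simple_T_graph: "simple_graph (T_graph n k)"
  by (simp add: T_graph_def simple_graph_join simple_disjoint_union simple_complete_graph)

text \<open>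
  Covers both extremal shapes: \<open>M\<close> is an edgeless graph for \<open>S_graph\<close> and a complete graph for
  \<open>T_graph\<close>. The three parts \<open>C\<close>, \<open>vset G - L - C\<close> and \<open>L\<close> are matched separately.
\<close>

lemma graph_iso_join_disjoint_union:
  assumes sg: "simple_graph G" and C: "C \<subseteq> vset G - L" and L: "L \<subseteq> vset G"
    and D: "\<And>w z. w \<in> vset G - L \<Longrightarrow> z \<in> vset G - L \<Longrightarrow> w \<noteq> z \<Longrightarrow> graph_adj G w z"
    and DL: "\<And>w x. w \<in> vset G - L \<Longrightarrow> x \<in> L \<Longrightarrow> graph_adj G w x \<longleftrightarrow> w \<in> C"
    and h: "bij_betw h L (vset M)" "\<And>x y. x \<in> L \<Longrightarrow> y \<in> L \<Longrightarrow> graph_adj G x y \<longleftrightarrow> graph_adj M (h x) (h y)"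
    and card: "card C = c" "card (vset G - L - C) = r"
  shows "graph_iso G (graph_join (complete_graph c) (disjoint_union (complete_graph r) M))"
proof -
  have fV: "finite (vset G)" using sg by (simp add: simple_graph_def)
  then have "finite C" using C finite_subset by blast
  then obtain f where f: "bij_betw f C {..<c}"
    using card(1) finite_same_card_bij[of C "{..<c}"] by auto
  obtain g where g: "bij_betw g (vset G - L - C) {..<r}"
    using card(2) fV finite_same_card_bij[of "vset G - L - C" "{..<r}"] by auto
  define F where "F = (\<lambda>x. if x \<in> C then Inl (f x) else if x \<in> L then Inr (Inr (h x)) else Inr (Inl (g x)))"
  have inF: "f x \<in> {..<c}" if "x \<in> C" for x using f that by (auto simp: bij_betw_def)
  have inG: "g x \<in> {..<r}" if "x \<in> vset G - L - C" for x using g that by (auto simp: bij_betw_def)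
  have inH: "h x \<in> vset M" if "x \<in> L" for x using h(1) that by (auto simp: bij_betw_def)
  have injs: "f x = f y \<longleftrightarrow> x = y" if "x \<in> C" "y \<in> C" for x y
    using f that by (auto simp: bij_betw_def inj_on_def)
  have injg: "g x = g y \<longleftrightarrow> x = y" if "x \<in> vset G - L - C" "y \<in> vset G - L - C" for x y
    using g that by (auto simp: bij_betw_def inj_on_def)
  have injh: "h x = h y \<longleftrightarrow> x = y" if "x \<in> L" "y \<in> L" for x y
    using h(1) that by (auto simp: bij_betw_def inj_on_def)
  let ?H = "graph_join (complete_graph c) (disjoint_union (complete_graph r) M)"
  have "F ` vset G = vset ?H"
  proof -
    have V: "vset G = C \<union> (vset G - L - C) \<union> L" using C L by auto
    then have "F ` vset G = F ` C \<union> F ` (vset G - L - C) \<union> F ` L"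
      by (metis image_Un)
    moreover have "F ` C = Inl ` f ` C" "F ` L = Inr ` Inr ` h ` L"
      "F ` (vset G - L - C) = Inr ` Inl ` g ` (vset G - L - C)"
      using C by (auto simp: F_def image_image intro!: image_cong)
    ultimately have "F ` vset G = Inl ` {..<c} \<union> Inr ` Inl ` {..<r} \<union> Inr ` Inr ` vset M"
      using f g h(1) by (simp only: bij_betw_def)
    then show ?thesis by (auto simp: Plus_def)
  qed
  moreover have "inj_on F (vset G)"
    by (auto simp: inj_on_def F_def injs injg injh split: if_splits)
  moreover have "graph_adj G x y \<longleftrightarrow> graph_adj ?H (F x) (F y)" if xy: "x \<in> vset G" "y \<in> vset G" for x y
  proof -
    have irr: "\<not> graph_adj G x x" using graph_adjD(3)[OF sg] by blast
    consider "x \<in> L" "y \<in> L" | "x \<in> L" "y \<in> vset G - L" | "x \<in> vset G - L" "y \<in> L"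
      | "x \<in> vset G - L" "y \<in> vset G - L" using xy by auto
    then show ?thesis
    proof cases
      case 1
      then have "x \<notin> C" "y \<notin> C" using C by auto
      then show ?thesis using 1 h(2) by (simp add: F_def)
    next
      case 2
      then have "x \<notin> C" using C by auto
      then show ?thesis using 2 DL[OF 2(2,1)] inF inH graph_adj_sym[of G x y]
        by (auto simp: F_def)
    next
      case 3
      then have "y \<notin> C" using C by auto
      then show ?thesis using 3 DL[OF 3] inF inH by (auto simp: F_def)
    next
      case 4
      have "graph_adj G x y \<longleftrightarrow> x \<noteq> y" using D[OF 4] irr by auto
      then show ?thesis using 4 inF inG injs injg by (auto simp: F_def)
    qed
  qed
  ultimately show ?thesis unfolding graph_iso_def bij_betw_def by (intro exI[of _ F]) simp
qed

lemma graph_iso_degree: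
  assumes "simple_graph G" "simple_graph H" "bij_betw f (vset G) (vset H)"
    and adj: "\<And>u v. u \<in> vset G \<Longrightarrow> v \<in> vset G \<Longrightarrow> graph_adj G u v \<longleftrightarrow> graph_adj H (f u) (f v)"
    and "v \<in> vset G"
  shows "vertex_degree H (f v) = vertex_degree G v"
proof -
  have "nbrs H (f v) = f ` nbrs G v"
  proof (intro set_eqI iffI)
    fix y assume y: "y \<in> nbrs H (f v)"
    then have "y \<in> vset H" using nbrs_subset[OF assms(2)] by auto
    then obtain x where "x \<in> vset G" "y = f x" using assms(3) by (auto simp: bij_betw_def)
    then show "y \<in> f ` nbrs G v" using y adj assms(5) by (auto simp: nbrs_def)
  next
    fix y assume "y \<in> f ` nbrs G v"
    then obtain x where x: "y = f x" "graph_adj G v x" by (auto simp: nbrs_def)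
    then have "x \<in> vset G" using graph_adjD(2)[OF assms(1)] by blast
    then show "y \<in> nbrs H (f v)" using x adj assms(5) by (auto simp: nbrs_def)
  qed
  moreover have "inj_on f (nbrs G v)"
    using assms(3) nbrs_subset[OF assms(1), of v] by (auto simp: bij_betw_def intro: inj_on_subset)
  ultimately show ?thesis
    by (simp add: vertex_degree_eq_card_nbrs[OF assms(1)] vertex_degree_eq_card_nbrs[OF assms(2)] card_image)
qed

text \<open>
  An isomorphism from the larger graph \<open>G'\<close> to \<open>H\<close> carries the edges absent from \<open>G\<close> to the set that
  has to be deleted from \<open>H\<close>. The required minimum degree is inherited from \<open>G\<close>.
\<close>

lemma in_deletion_family:
  assumes sg: "simple_graph G" "simple_graph G'" "simple_graph H"
    and V: "vset G' = vset G" and E: "eset G \<subseteq> eset G'"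
    and iso: "graph_iso G' H" and mind: "3 \<le> min_degree G"
  shows "in_family G (deletion_family H (card (eset G') - card (eset G)))"
proof (cases "card (eset G') = card (eset G)")
  case True
  then have "eset G = eset G'" using E card_subset_eq[OF finite_eset[OF sg(2)]] by simp
  then have "G = G'" using V by simp
  then show ?thesis using True iso by (simp add: in_family_def deletion_family_def)
next
  case False
  obtain f where f: "bij_betw f (vset G) (vset H)"
    and adj: "\<And>u v. u \<in> vset G \<Longrightarrow> v \<in> vset G \<Longrightarrow> graph_adj G' u v \<longleftrightarrow> graph_adj H (f u) (f v)"
    using iso by (auto simp: graph_iso_def V)
  let ?X = "eset G' - eset G"
  define F where "F = (`) f ` ?X"
  have inj: "inj_on ((`) f) (Pow (vset G))"
    using f by (intro inj_on_image_Pow) (simp add: bij_betw_def)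
  have X: "?X \<subseteq> Pow (vset G)" using sg(2) V by (auto simp: simple_graph_def)
  have "F \<subseteq> eset H"
  proof
    fix e' assume "e' \<in> F"
    then obtain e where e: "e' = f ` e" "e \<in> eset G'" by (auto simp: F_def)
    then have "card e = 2" "e \<subseteq> vset G" using sg(2) V by (auto simp: simple_graph_def)
    then obtain u v where "e = {u, v}" "u \<in> vset G" "v \<in> vset G" by (auto simp: card_2_iff)
    then show "e' \<in> eset H" using e adj by (simp add: graph_adj_def)
  qed
  moreover have "card F = card (eset G') - card (eset G)"
    using inj_on_subset[OF inj X] E finite_eset[OF sg(1)]
    by (simp add: F_def card_image card_Diff_subset)
  moreover have adj': "graph_adj G u v \<longleftrightarrow> graph_adj (delete_edges H F) (f u) (f v)"
    if "u \<in> vset G" "v \<in> vset G" for u v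
  proof -
    have "{f u, f v} \<in> F \<longleftrightarrow> {u, v} \<in> ?X"
      using inj_on_image_mem_iff[OF inj, of "{u, v}" ?X] X that by (simp add: F_def)
    then show ?thesis using adj[OF that] E by (auto simp: graph_adj_def delete_edges_def)
  qed
  moreover have "min_degree (delete_edges H F) = min_degree G"
  proof -
    have "simple_graph (delete_edges H F)" using sg(3) by (auto simp: simple_graph_def delete_edges_def)
    then have "vertex_degree (delete_edges H F) (f v) = vertex_degree G v" if "v \<in> vset G" for v
      using graph_iso_degree[OF sg(1) _ _ adj' that] f by (simp add: delete_edges_def)
    moreover have "vset (delete_edges H F) = f ` vset G"
      using f by (simp add: delete_edges_def bij_betw_def)
    ultimately show ?thesis by (simp add: min_degree_def image_image)
  qed
  ultimately have "delete_edges H F \<in> deletion_family H (card (eset G') - card (eset G))"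
    using False E card_mono[OF finite_eset[OF sg(2)] E] mind by (auto simp: deletion_family_def)
  moreover have "graph_iso G (delete_edges H F)"
    using f adj' by (auto simp: graph_iso_def delete_edges_def)
  ultimately show ?thesis by (auto simp: in_family_def)
qed

section \<open>Dense graphs that are not Hamilton-connected\<close>

text \<open>
  The bounds on the number of edges accompany the isomorphisms because they limit how many edges
  separate the original graph from its maximal extension. For \<open>T_graph\<close> the edge inside \<open>L\<close> lowers
  the bound by one.
\<close>

lemma extremal_closed_graphs:
  fixes n :: nat
  assumes sg: "simple_graph G" and oc: "ore_closed G"
    and nc: "\<exists>u \<in> vset G. \<exists>v \<in> vset G. u \<noteq> v \<and> \<not> graph_adj G u v"
    and n: "n = card (vset G)" "11 \<le> n" and m: "((n - 3) choose 2) + 13 \<le> card (eset G)"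
    and mind: "\<And>x. x \<in> vset G \<Longrightarrow> 3 \<le> vertex_degree G x"
  shows "(\<exists>k. (k = 3 \<or> (n, k) \<in> {(11, 5), (12, 6), (13, 6), (14, 7), (16, 8)}) \<and>
             graph_iso G (S_graph n k) \<and> card (eset G) \<le> ((n - (k - 1)) choose 2) + (k - 1) * k) \<or>
         (graph_iso G (T_graph n 3) \<and> card (eset G) \<le> ((n - 2) choose 2) + 5)"
proof -
  obtain u L where uL: "u \<in> vset G" "L \<subseteq> vset G" "card L = vertex_degree G u - 1"
    "2 * vertex_degree G u \<le> n" "\<And>x. x \<in> L \<Longrightarrow> vertex_degree G x \<le> vertex_degree G u"
    using low_degree_set[OF sg oc nc] n(1) by metis
  define k where "k = vertex_degree G u"
  have k3: "3 \<le> k" and kn: "2 * k \<le> n" using mind[OF uL(1)] uL(4) by (simp_all add: k_def)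
  have L: "L \<subseteq> vset G" "card L = k - 1" "\<And>x. x \<in> L \<Longrightarrow> vertex_degree G x \<le> k"
    using uL by (auto simp: k_def)
  have fV: "finite (vset G)" using sg by (simp add: simple_graph_def)
  then have fL: "finite L" using L(1) finite_subset by blast
  have "(\<Sum>x\<in>L. vertex_degree G x) \<le> (k - 1) * k"
    using sum_bounded_above[of L "vertex_degree G" k] L(2,3) by simp
  then have count: "card (eset G) + card {e \<in> eset G. e \<subseteq> L} \<le> ((n - (k - 1)) choose 2) + (k - 1) * k"
    using edge_bound[OF sg L(1)] L(1,2) fL n(1) by (simp add: card_Diff_subset)
  then have k: "k = 3 \<or> (n, k) \<in> {(11, 5), (12, 6), (13, 6), (14, 7), (16, 8)}"
    using critical_parameters[OF k3 kn n(2)] m by linarith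
  obtain C where C: "C \<subseteq> vset G - L"
    "\<And>w z. w \<in> vset G - L \<Longrightarrow> z \<in> vset G - L \<Longrightarrow> w \<noteq> z \<Longrightarrow> graph_adj G w z"
    "\<And>w x. w \<in> vset G - L \<Longrightarrow> x \<in> L \<Longrightarrow> graph_adj G w x \<longleftrightarrow> w \<in> C"
    and alt: "(card C = k \<and> (\<forall>x\<in>L. \<forall>y\<in>L. \<not> graph_adj G x y)) \<or>
     (k = 3 \<and> card C = 2 \<and> (\<forall>x\<in>L. \<forall>y\<in>L. x \<noteq> y \<longrightarrow> graph_adj G x y))"
    using closed_graph_structure[OF sg oc n m mind k L] by blast
  have "finite C" using C(1) fV finite_subset by blast
  then have R: "card (vset G - L - C) = n - (k - 1) - card C"
    using C(1) fL L(1,2) n(1) by (simp add: card_Diff_subset)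
  obtain h where h: "bij_betw h L {..<k - 1}"
    using L(2) fL finite_same_card_bij[of L "{..<k - 1}"] by auto
  from alt show ?thesis
  proof
    assume *: "card C = k \<and> (\<forall>x\<in>L. \<forall>y\<in>L. \<not> graph_adj G x y)"
    have bij: "bij_betw (\<lambda>x. (h x, 0)) L (vset (graph_copies (k - 1) (complete_graph 1)))"
      using h by (auto simp: bij_betw_def inj_on_def)
    have "graph_iso G (S_graph n k)"
      unfolding S_graph_def
      by (rule graph_iso_join_disjoint_union[OF sg C(1) L(1) C(2,3) bij])
        (use * R kn k3 in auto)
    then show ?thesis using k count by (intro disjI1 exI[of _ k]) simp
  next
    assume *: "k = 3 \<and> card C = 2 \<and> (\<forall>x\<in>L. \<forall>y\<in>L. x \<noteq> y \<longrightarrow> graph_adj G x y)"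
    have hadj: "graph_adj G x y \<longleftrightarrow> graph_adj (complete_graph (3 - 1)) (h x) (h y)"
      if "x \<in> L" "y \<in> L" for x y
    proof -
      have "graph_adj G x y \<longleftrightarrow> x \<noteq> y" using * that graph_adjD(3)[OF sg] by blast
      moreover have "h x < 2" "h y < 2" "h x = h y \<longleftrightarrow> x = y"
        using h that * by (auto simp: bij_betw_def inj_on_def)
      ultimately show ?thesis by simp
    qed
    have "graph_iso G (T_graph n 3)"
      unfolding T_graph_def
      by (rule graph_iso_join_disjoint_union[OF sg C(1) L(1) C(2,3), where h = h])
        (use * R h hadj in auto)
    moreover have "0 < card {e \<in> eset G. e \<subseteq> L}"
    proof -
      obtain x y where "L = {x, y}" "x \<noteq> y" using L(2) * by (auto simp: card_2_iff)
      then have "L \<in> {e \<in> eset G. e \<subseteq> L}" using * by (auto simp: graph_adj_def)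
      then show ?thesis using finite_eset[OF sg] by (auto simp: card_gt_0_iff)
    qed
    ultimately show ?thesis using count * by simp
  qed
qed

lemma in_family_Un: "in_family G (\<A> \<union> \<B>) \<longleftrightarrow> in_family G \<A> \<or> in_family G \<B>"
  by (auto simp: in_family_def)

lemma in_family_UN: "in_family G (\<Union>i\<in>I. \<A> i) \<longleftrightarrow> (\<exists>i\<in>I. in_family G (\<A> i))"
  by (auto simp: in_family_def)

theorem theorem1p3:
  fixes G :: "'v sgraph" and n m :: nat
  assumes "simple_graph G"
    and "graph_connected G"
    and "n = card (vset G)"
    and "m = card (eset G)"
    and "n \<ge> 11"
    and "min_degree G \<ge> 3"
    and "m \<ge> ((n - 3) choose 2) + 13"
  shows "hamilton_connected G
    \<or> (in_family G (\<Union>i\<in>{0..n - 10}. S_family n 3 i)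
         \<or> in_family G (\<Union>i\<in>{0..n - 11}. T_family n 3 i))
    \<or> (n = 11 \<and> graph_iso G (S_graph 11 5))
    \<or> (n = 12 \<and> in_family G (\<Union>i\<in>{0..2}. S_family 12 6 i))
    \<or> (n = 13 \<and> graph_iso G (S_graph 13 6))
    \<or> (n = 14 \<and> in_family G ((\<Union>i\<in>{0..2}. S_family 14 7 i) \<union> S_family 14 3 4))
    \<or> (n = 16 \<and> (in_family G (\<Union>i\<in>{0..1}. S_family 16 8 i)
         \<or> graph_iso G (graph_join (complete_graph 7)
              (disjoint_union (complete_graph 2) (complete_bipartite_graph 1 6)))))"
proof (cases "hamilton_connected G")
  case False
  note sg = assms(1)
  obtain H where H: "simple_graph H" "vset H = vset G" "eset G \<subseteq> eset H" "ore_closed H"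
    "\<exists>u \<in> vset H. \<exists>v \<in> vset H. u \<noteq> v \<and> \<not> graph_adj H u v"
    using maximal_extension[OF sg False] by blast
  define t where "t = card (eset H) - card (eset G)"
  have le: "card (eset G) \<le> card (eset H)" using card_mono[OF finite_eset[OF H(1)] H(3)] .
  have "3 \<le> vertex_degree H x" if "x \<in> vset H" for x
  proof -
    have "finite (vset G)" using sg by (simp add: simple_graph_def)
    then have "min_degree G \<le> vertex_degree G x" using that H(2) by (simp add: min_degree_def)
    also have "\<dots> \<le> vertex_degree H x"
      unfolding vertex_degree_def using H(3) finite_eset[OF H(1)] by (intro card_mono) auto
    finally show ?thesis using assms(6) by simp
  qed
  then consider k where "k = 3 \<or> (n, k) \<in> {(11, 5), (12, 6), (13, 6), (14, 7), (16, 8)}"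
      "graph_iso H (S_graph n k)" "card (eset H) \<le> ((n - (k - 1)) choose 2) + (k - 1) * k"
    | "graph_iso H (T_graph n 3)" "card (eset H) \<le> ((n - 2) choose 2) + 5"
    using extremal_closed_graphs[OF H(1,4,5) _ assms(5)] H(2) assms(3,4,7) le by fastforce
  moreover have choose: "((n - 2) choose 2) = (n - 3) + ((n - 3) choose 2)"
  proof -
    have "n - 2 = Suc (n - 3)" using assms(5) by simp
    then show ?thesis by (simp add: numeral_2_eq_2)
  qed
  ultimately show ?thesis
  proof cases
    case 1
    have fam: "in_family G (S_family n k t)"
      unfolding S_family_def t_def
      by (rule in_deletion_family[OF sg H(1) simple_S_graph H(2,3) 1(2) assms(6)])
    have t: "((n - 3) choose 2) + 13 + t \<le> ((n - (k - 1)) choose 2) + (k - 1) * k"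
      using 1(3) assms(4,7) le by (simp add: t_def)
    from 1(1) show ?thesis
    proof (elim disjE insertE)
      assume "k = 3"
      then have "t \<in> {0..n - 10}" using t choose assms(5) by simp
      then show ?thesis using fam \<open>k = 3\<close> by (auto simp: in_family_UN)
    next
      assume "(n, k) = (11, 5)"
      then have "n = 11" "k = 5" "t = 0" using t by (auto simp: choose_two)
      then show ?thesis using fam by (simp add: S_family_def deletion_family_def in_family_def)
    next
      assume "(n, k) = (12, 6)"
      then have "n = 12" "k = 6" "t \<in> {0..2}" using t by (auto simp: choose_two)
      then have "n = 12 \<and> in_family G (\<Union>i\<in>{0..2}. S_family 12 6 i)"
        using fam unfolding in_family_UN by blast
      then show ?thesis by blast
    next
      assume "(n, k) = (13, 6)"
      then have "n = 13" "k = 6" "t = 0" using t by (auto simp: choose_two)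
      then show ?thesis using fam by (simp add: S_family_def deletion_family_def in_family_def)
    next
      assume "(n, k) = (14, 7)"
      then have "n = 14" "k = 7" "t \<in> {0..2}" using t by (auto simp: choose_two)
      then have "n = 14 \<and> in_family G ((\<Union>i\<in>{0..2}. S_family 14 7 i) \<union> S_family 14 3 4)"
        using fam unfolding in_family_Un in_family_UN by blast
      then show ?thesis by blast
    next
      assume "(n, k) = (16, 8)"
      then have "n = 16" "k = 8" "t \<in> {0..1}" using t by (auto simp: choose_two)
      then have "n = 16 \<and> in_family G (\<Union>i\<in>{0..1}. S_family 16 8 i)"
        using fam unfolding in_family_UN by blast
      then show ?thesis by blast
    qed simp
  next
    case 2
    have fam: "in_family G (T_family n 3 t)"
      unfolding T_family_def t_def
      by (rule in_deletion_family[OF sg H(1) simple_T_graph H(2,3) 2(1) assms(6)])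
    have "t \<in> {0..n - 11}" using 2(2) assms(4,5,7) le choose by (simp add: t_def)
    then show ?thesis using fam by (auto simp: in_family_UN)
  qed
qed simp

end
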